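(* Let $w$ be the Farey-Christoffel word associated to a positive reduced fraction $\frac pq$. The Farey-Christoffel words associated to its descendants $\frac p{p+q}$ and $\frac{p+q}q$ are obtained by applying to $w$ the substitutions $S_0$ and $S_1$ respectively, where $$S_0:\ (0,1)\to(0,01),\qquad S_1:\ (0,1)\to(01,1).$$ That is, $w_{p/(p+q)}=S_0(w)$ and $w_{(p+q)/q}=S_1(w)$.
   Context: All fractions are in lowest terms; $\frac01$ and $\frac10$ are allowed as formal fractions. A pair of nonnegative fractions $\frac ab<\frac cd$ is a Farey pair if $bc-ad=1$; its mediant is $\frac ab\oplus\frac cd=\frac{a+c}{b+d}$. Every positive rational is the mediant of exactly one Farey pair. Farey-Christoffel words: $w_{0/1}=0$, $w_{1/0}=1$, and $w_{p/q}=w_{p'/q'}\,w_{p''/q''}$ (concatenation) whenever $\frac{p'}{q'}<\frac{p''}{q''}$ is a Farey pair with mediant $\frac pq$. A substitution $(0,1)\to(a,b)$ is the monoid morphism of $\{0,1\}^*$ replacing each letter $0$ by the word $a$ and each letter $1$ by the word $b$. The left and right descendants of $\frac pq$ are $\frac p{p+q}$ and $\frac{p+q}q$. *)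

theory Defs
  imports Main
begin

text \<open>The pair \<open>(p, q)\<close> stands for the formal fraction \<open>p/q\<close>, so that \<open>(1, 0)\<close> is \<open>1/0\<close>.\<close>

type_synonym fraction = "nat \<times> nat"

text \<open>The determinant condition alone gives \<open>a/b < c/d\<close> and that both fractions are in lowest
  terms.\<close>

fun farey_pair :: "fraction \<Rightarrow> fraction \<Rightarrow> bool" where
  "farey_pair (a, b) (c, d) \<longleftrightarrow> int b * int c - int a * int d = 1"

fun mediant :: "fraction \<Rightarrow> fraction \<Rightarrow> fraction" where
  "mediant (a, b) (c, d) = (a + c, b + d)"

definition farey_parents :: "fraction \<Rightarrow> fraction \<times> fraction \<Rightarrow> bool" where
  "farey_parents x lr \<longleftrightarrow> farey_pair (fst lr) (snd lr) \<and> mediant (fst lr) (snd lr) = x"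

datatype letter = L0 | L1

lemma farey_pair_coprime:
  assumes "farey_pair (a, b) (c, d)"
  shows "coprime a b" "coprime c d"
proof -
  have e: "int b * int c - int a * int d = 1" using assms by simp
  have "is_unit g" if "g dvd int a" "g dvd int b" for g
    using that e by (metis dvd_diff dvd_mult2)
  then have "coprime (int a) (int b)" by (rule coprimeI)
  then show "coprime a b" by simp
  have "is_unit g" if "g dvd int c" "g dvd int d" for g
    using that e by (metis dvd_diff dvd_mult)
  then have "coprime (int c) (int d)" by (rule coprimeI)
  then show "coprime c d" by simp
qed

lemma farey_pair_pos:
  assumes "farey_pair (a, b) (c, d)"
  shows "0 < b" "0 < c"
proof -
  have e: "int b * int c = 1 + int a * int d" using assms by simp
  have "int b * int c > 0" unfolding e by (simp add: add_pos_nonneg)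
  then show "0 < b" "0 < c" by (auto intro: gr0I)
qed

lemma farey_parents_smaller:
  assumes "farey_parents x (l, r)"
  shows "fst l + snd l < fst x + snd x" "fst r + snd r < fst x + snd x"
  using assms farey_pair_pos[of "fst l" "snd l" "fst r" "snd r"]
  by (cases l; cases r; auto simp: farey_parents_def)+

text \<open>The word of a pair that is not in lowest terms is irrelevant and comes out as \<open>[]\<close>.  The
  uniqueness guard holds for every positive reduced fraction (\<open>farey_parents_ex1\<close>), and the defining
  recursion holds for every Farey pair (\<open>fc_word_mediant\<close>).\<close>

function fc_word :: "fraction \<Rightarrow> letter list" where
  "fc_word x =
    (if x = (0, 1) then [L0]
     else if x = (1, 0) then [L1]
     else if \<exists>!lr. farey_parents x lr then
       fc_word (fst (THE lr. farey_parents x lr)) @ fc_word (snd (THE lr. farey_parents x lr))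
     else [])"
  by auto
termination
proof (relation "Wellfounded.measure (\<lambda>x. fst x + snd x)")
  show "wf (Wellfounded.measure (\<lambda>x::fraction. fst x + snd x))" by simp
next
  fix x :: fraction assume "\<exists>!lr. farey_parents x lr"
  then have "farey_parents x (THE lr. farey_parents x lr)" by (rule theI')
  then show "(fst (THE lr. farey_parents x lr), x) \<in> Wellfounded.measure (\<lambda>x. fst x + snd x)"
    using farey_parents_smaller(1)[of x "fst (THE lr. farey_parents x lr)"
        "snd (THE lr. farey_parents x lr)"] by simp
next
  fix x :: fraction assume "\<exists>!lr. farey_parents x lr"
  then have "farey_parents x (THE lr. farey_parents x lr)" by (rule theI')
  then show "(snd (THE lr. farey_parents x lr), x) \<in> Wellfounded.measure (\<lambda>x. fst x + snd x)"
    using farey_parents_smaller(2)[of x "fst (THE lr. farey_parents x lr)"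
        "snd (THE lr. farey_parents x lr)"] by simp
qed

declare fc_word.simps [simp del]

lemma farey_parents_unique:
  assumes 1: "farey_parents x lr" and 2: "farey_parents x lr'"
  shows "lr' = lr"
proof -
  obtain a b c d where lr: "lr = ((a, b), (c, d))" by (metis prod.exhaust)
  obtain a' b' c' d' where lr': "lr' = ((a', b'), (c', d'))" by (metis prod.exhaust)
  define p q where "p = fst x" and "q = snd x"
  have p: "p = a + c" "p = a' + c'" and q: "q = b + d" "q = b' + d'"
    using assms by (auto simp: lr lr' farey_parents_def p_def q_def)
  have f: "farey_pair (a, b) (c, d)" "farey_pair (a', b') (c', d')"
    using assms by (auto simp: lr lr' farey_parents_def)
  note pos = farey_pair_pos[OF f(1)] farey_pair_pos[OF f(2)]
  have e: "int b * int c - int a * int d = 1" "int b' * int c' - int a' * int d' = 1"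
    using f by simp_all
  have "int b * int p - int a * int q = 1" using e(1) by (simp add: p(1) q(1) algebra_simps)
  moreover have "int b' * int p - int a' * int q = 1"
    using e(2) by (simp add: p(2) q(2) algebra_simps)
  ultimately have eq: "(int b - int b') * int p = (int a - int a') * int q"
    by (simp add: algebra_simps)
  have "(int b - int b') * (int b * int p - int a * int q)
      = int q * (int b * (int a - int a') - int a * (int b - int b'))"
  proof -
    have "(int b - int b') * (int b * int p - int a * int q)
        = int b * ((int b - int b') * int p) - int a * int q * (int b - int b')"
      by (simp add: algebra_simps)
    then show ?thesis unfolding eq by (simp add: algebra_simps)
  qed
  then have "int q dvd int b - int b'"
    unfolding \<open>int b * int p - int a * int q = 1\<close> mult_1_right by (rule dvdI)
  moreover have "\<bar>int b - int b'\<bar> < int q" using pos q by linarith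
  ultimately have "int b - int b' = 0"
    using dvd_imp_le_int[of "int b - int b'" "int q"] by fastforce
  then have "b = b'" by simp
  with eq pos q have "a = a'" by auto
  with \<open>b = b'\<close> p q show ?thesis by (simp add: lr lr')
qed

lemma farey_parents_exists:
  assumes "0 < p" "0 < q" "coprime p q"
  shows "\<exists>lr. farey_parents (p, q) lr"
  using assms
proof (induction "p + q" arbitrary: p q rule: less_induct)
  case less
  consider "p = q" | "p < q" | "q < p" by linarith
  then show ?case
  proof cases
    case 1
    then have "farey_parents (p, q) ((0, 1), (1, 0))"
      using less.prems by (simp add: farey_parents_def)
    then show ?thesis by blast
  next
    case 2
    have "coprime p (q - p)"
      using less.prems(3) 2 by (metis coprime_iff_gcd_eq_1 gcd.commute gcd_diff1_nat less_imp_le)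
    then obtain l r where "farey_parents (p, q - p) (l, r)"
      using less.hyps[of p "q - p"] less.prems 2 by auto
    then have "farey_parents (p, q) ((fst l, fst l + snd l), (fst r, fst r + snd r))"
      using 2 by (cases l; cases r) (auto simp: farey_parents_def algebra_simps)
    then show ?thesis by blast
  next
    case 3
    have "coprime (p - q) q"
      using less.prems(3) 3 by (metis coprime_iff_gcd_eq_1 gcd_diff1_nat less_imp_le)
    then obtain l r where "farey_parents (p - q, q) (l, r)"
      using less.hyps[of "p - q" q] less.prems 3 by auto
    then have "farey_parents (p, q) ((fst l + snd l, snd l), (fst r + snd r, snd r))"
      using 3 by (cases l; cases r) (auto simp: farey_parents_def algebra_simps)
    then show ?thesis by blast
  qed
qed

lemma farey_parents_ex1:
  assumes "0 < p" "0 < q" "coprime p q"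
  shows "\<exists>!lr. farey_parents (p, q) lr"
  using farey_parents_exists[OF assms] farey_parents_unique by blast

lemma fc_word_base: "fc_word (0, 1) = [L0]" "fc_word (1, 0) = [L1]"
  by (subst fc_word.simps, simp)+

lemma fc_word_mediant:
  assumes "farey_pair l r"
  shows "fc_word (mediant l r) = fc_word l @ fc_word r"
proof -
  have par: "farey_parents (mediant l r) (l, r)" using assms by (simp add: farey_parents_def)
  then have ex1: "\<exists>!lr. farey_parents (mediant l r) lr" using farey_parents_unique by blast
  have the: "(THE lr. farey_parents (mediant l r) lr) = (l, r)"
    using par farey_parents_unique by (intro the_equality) blast+
  have "mediant l r \<noteq> (0, 1)" "mediant l r \<noteq> (1, 0)"
    using assms farey_pair_pos[of "fst l" "snd l" "fst r" "snd r"] by (cases l; cases r; auto)+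
  then show ?thesis by (subst fc_word.simps) (simp add: ex1 the)
qed

definition substitution :: "letter list \<Rightarrow> letter list \<Rightarrow> letter list \<Rightarrow> letter list" where
  "substitution a b w = concat (map (\<lambda>x. case x of L0 \<Rightarrow> a | L1 \<Rightarrow> b) w)"

definition S0 :: "letter list \<Rightarrow> letter list" where
  "S0 = substitution [L0] [L0, L1]"

definition S1 :: "letter list \<Rightarrow> letter list" where
  "S1 = substitution [L0, L1] [L1]"

end

theory Submission imports Defs begin

text \<open>The maps \<open>p/q \<mapsto> p/(p+q)\<close> and \<open>p/q \<mapsto> (p+q)/q\<close> preserve Farey pairs and commute with
  mediants, while \<open>S0\<close> and \<open>S1\<close> are monoid morphisms.  Both sides of each identity therefore obey
  the same recursion along Farey parents, and it is enough to compare them at \<open>0/1\<close> and \<open>1/0\<close>.\<close>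

lemma substitution_append: "substitution a b (v @ w) = substitution a b v @ substitution a b w"
  by (simp add: substitution_def)

text \<open>Needed for both base cases: 0/1 and 1/0 each have 1/1 and themselves as
  descendants.\<close>

lemma fc_word_one_one: "fc_word (1, 1) = [L0, L1]"
  using fc_word_mediant[of "(0, 1)" "(1, 0)"] fc_word_base by simp

text \<open>Admitting 0/1 and 1/0 lets the induction hypothesis apply to both Farey parents, even
  when one of them is a formal endpoint.\<close>

lemma fc_word_descendants:
  assumes "coprime p q"
  shows "fc_word (p, p + q) = S0 (fc_word (p, q)) \<and> fc_word (p + q, q) = S1 (fc_word (p, q))"
  using assms
proof (induction "p + q" arbitrary: p q rule: less_induct)
  case less
  consider "p = 0" "q = 1" | "p = 1" "q = 0" | "0 < p" "0 < q"
    using less.prems by (cases "p = 0"; cases "q = 0") auto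
  then show ?case
  proof cases
    case 1
    then show ?thesis
      using fc_word_base fc_word_one_one by (simp add: S0_def S1_def substitution_def)
  next
    case 2
    then show ?thesis
      using fc_word_base fc_word_one_one by (simp add: S0_def S1_def substitution_def)
  next
    case 3
    then obtain a b c d where par: "farey_parents (p, q) ((a, b), (c, d))"
      using farey_parents_exists[OF _ _ less.prems] by (metis prod.exhaust)
    then have pair: "farey_pair (a, b) (c, d)" and pq: "p = a + c" "q = b + d"
      by (auto simp: farey_parents_def)
    have word: "fc_word (p, q) = fc_word (a, b) @ fc_word (c, d)"
      using fc_word_mediant[OF pair] pq by simp
    \<comment> \<open>Both maps are shears of determinant 1, so they preserve the Farey
      determinant.\<close>
    have "farey_pair (a, a + b) (c, c + d)" "farey_pair (a + b, b) (c + d, d)"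
      using pair by (simp_all add: algebra_simps)
    from this[THEN fc_word_mediant]
    have "fc_word (p, p + q) = fc_word (a, a + b) @ fc_word (c, c + d)"
      "fc_word (p + q, q) = fc_word (a + b, b) @ fc_word (c + d, d)"
      by (simp_all add: pq ac_simps)
    moreover have "a + b < p + q" "c + d < p + q"
      using farey_parents_smaller[OF par] by simp_all
    ultimately show ?thesis
      using less.hyps[of a b] less.hyps[of c d] farey_pair_coprime[OF pair]
      by (simp add: word S0_def S1_def substitution_append)
  qed
qed

theorem lemma3p6:
  fixes p q :: nat
  assumes "0 < p" and "0 < q" and "coprime p q"
  shows "fc_word (p, p + q) = S0 (fc_word (p, q)) \<and>
         fc_word (p + q, q) = S1 (fc_word (p, q))"
  using assms(3) by (rule fc_word_descendants)

end
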